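(* Let $a_1,a_2,b_1,b_2\in\mathbb{R}$ with $a_1\leq a_2$ and $0<b_1\leq b_2$. Then: (i) For $r(x)=\frac{x+a_1}{x+b_1}$, the sequence $\{r(n)\}_{n\in\mathbb{Z}_+}$ is completely alternating if and only if $a_1\leq b_1$. (ii) For $r(x)=\frac{(x+a_1)(x+a_2)}{(x+b_1)(x+b_2)}$, the sequence $\{r(n)\}_{n\in\mathbb{Z}_+}$ is completely alternating if and only if $a_1\leq b_1\leq a_2$ and $a_1+a_2\leq b_1+b_2$. (iii) For $r(x)=\frac{(x+a_1)(x+a_2)}{x+b_1}$, the sequence $\{r(n)\}_{n\in\mathbb{Z}_+}$ is completely alternating if and only if $a_1\leq b_1\leq a_2$.
   Context: $\mathbb{Z}_+=\{0,1,2,\dots\}$. For $a\in\mathbb{Z}_+$ and $\psi:\mathbb{Z}_+\to\mathbb{R}$, $(\nabla_a\psi)(m)=\psi(m)-\psi(m+a)$. A sequence $\psi:\mathbb{Z}_+\to\mathbb{R}$ is completely alternating if $\nabla_{a_1}\cdots\nabla_{a_n}\psi(m)\leq 0$ for all $n\geq 1$, all $a_1,\dots,a_n\in\mathbb{Z}_+$ (repetitions allowed) and all $m\in\mathbb{Z}_+$ (here the $a_i$ are dummy variables unrelated to those in the claim). *)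

theory Defs
  imports Complex_Main
begin

definition nabla :: "nat \<Rightarrow> (nat \<Rightarrow> real) \<Rightarrow> (nat \<Rightarrow> real)" where
  "nabla a \<psi> = (\<lambda>m. \<psi> m - \<psi> (m + a))"

(* foldr nabla [a1, ..., an] \<psi> is nabla a1 (... (nabla an \<psi>)); the nonempty list
   encodes the tuple (a1, ..., an) with n \<ge> 1, repetitions allowed. *)
definition completely_alternating :: "(nat \<Rightarrow> real) \<Rightarrow> bool" where
  "completely_alternating \<psi> \<longleftrightarrow>
     (\<forall>as. as \<noteq> [] \<longrightarrow> (\<forall>m. foldr nabla as \<psi> m \<le> 0))"

end

theory Submission
  imports Defs "HOL-Real_Asymp.Real_Asymp"
begin

text \<open>
  Up to affine terms, each of the three sequences is the negative of
  $h(n) = P/(n+b_2) + Q/((n+b_1)(n+b_2))$. Products, shifts and differences of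
  the sequences $1/(n+b)$ are again nonnegative combinations of products of such sequences,
  which gives sufficiency of $P, Q \ge 0$. Conversely, $n\,h(n) \to P$ forces $P \ge 0$, and in
  $\nabla_1^N h(0)$ the $Q$-term exceeds the $P$-term by a factor growing at least
  like $\ln N$, which forces $Q \ge 0$.
\<close>

section \<open>Completely monotone sequences\<close>

lemma foldr_nabla_uminus: "foldr nabla as (\<lambda>m. - f m) = (\<lambda>m. - foldr nabla as f m)"
  by (induction as) (auto simp: nabla_def)

text \<open>A generated subclass of the completely monotone sequences. Giving it by generators and
  closure rules lets closure under \<open>nabla\<close> be proved by rule induction, with no
  integral representation.\<close>

inductive cm_cone :: "(nat \<Rightarrow> real) \<Rightarrow> bool" where
  const: "c \<ge> 0 \<Longrightarrow> cm_cone (\<lambda>m. c)"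
| inv: "b > 0 \<Longrightarrow> cm_cone (\<lambda>m. 1 / (real m + b))"
| add: "cm_cone f \<Longrightarrow> cm_cone g \<Longrightarrow> cm_cone (\<lambda>m. f m + g m)"
| mult: "cm_cone f \<Longrightarrow> cm_cone g \<Longrightarrow> cm_cone (\<lambda>m. f m * g m)"

lemma cm_cone_nonneg: "cm_cone f \<Longrightarrow> f m \<ge> 0"
  by (induction rule: cm_cone.induct) auto

lemma cm_cone_shift: "cm_cone f \<Longrightarrow> cm_cone (\<lambda>m. f (m + a))"
proof (induction rule: cm_cone.induct)
  case (inv b)
  then show ?case
    using cm_cone.inv[of "real a + b"] by (simp add: add.assoc)
qed (auto intro: cm_cone.intros)

text \<open>The generator 1/(m+b) has difference a/((m+b)(m+a+b)), and in the product rule every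
  term carries a plus sign once one factor is shifted, so no step leaves the cone.\<close>

lemma cm_cone_nabla: "cm_cone f \<Longrightarrow> cm_cone (nabla a f)"
proof (induction rule: cm_cone.induct)
  case (const c)
  then show ?case by (simp add: nabla_def cm_cone.const)
next
  case (inv b)
  have "nabla a (\<lambda>m. 1 / (real m + b))
      = (\<lambda>m. real a * (1 / (real m + b) * (1 / (real m + (real a + b)))))"
  proof
    fix m
    have "real m + b \<noteq> 0" "real m + (real a + b) \<noteq> 0"
      using inv by linarith+
    then show "nabla a (\<lambda>m. 1 / (real m + b)) m
        = real a * (1 / (real m + b) * (1 / (real m + (real a + b))))"
      by (simp add: nabla_def divide_simps)
  qed
  moreover have "cm_cone (\<lambda>m. real a * (1 / (real m + b) * (1 / (real m + (real a + b)))))"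
    using inv by (intro cm_cone.mult cm_cone.inv cm_cone.const) auto
  ultimately show ?case by simp
next
  case (add f g)
  have "nabla a (\<lambda>m. f m + g m) = (\<lambda>m. nabla a f m + nabla a g m)"
    by (auto simp: nabla_def)
  then show ?case using add by (simp add: cm_cone.add)
next
  case (mult f g)
  have "nabla a (\<lambda>m. f m * g m) = (\<lambda>m. nabla a f m * g m + f (m + a) * nabla a g m)"
    by (auto simp: nabla_def algebra_simps)
  then show ?case using mult by (auto intro!: cm_cone.add cm_cone.mult cm_cone_shift)
qed

lemma cm_cone_foldr_nabla: "cm_cone f \<Longrightarrow> cm_cone (foldr nabla as f)"
  by (induction as) (auto intro: cm_cone_nabla)

lemma completely_alternating_affine_minus_cm_cone:
  assumes "cm_cone k" and "d \<ge> 0" and \<psi>: "\<And>m. \<psi> m = c + d * real m - k m"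
  shows "completely_alternating \<psi>"
  unfolding completely_alternating_def
proof (intro allI impI)
  fix as :: "nat list" and m
  assume "as \<noteq> []"
  \<comment> \<open>\<open>foldr\<close> applies the last entry first. That one difference removes c
    and turns the linear term into the constant -d*a, leaving the negative of a cone element for the
    remaining entries.\<close>
  then obtain bs a where as: "as = bs @ [a]" by (metis rev_exhaust)
  let ?g = "\<lambda>m. d * real a + nabla a k m"
  have "nabla a \<psi> = (\<lambda>m. - ?g m)"
    by (auto simp: nabla_def \<psi> algebra_simps)
  then have "foldr nabla as \<psi> m = - foldr nabla bs ?g m"
    unfolding as by (simp only: foldr_append foldr.simps o_apply id_apply foldr_nabla_uminus)
  moreover have "cm_cone ?g"
    using assms by (intro cm_cone.add cm_cone.const cm_cone_nabla) auto
  ultimately show "foldr nabla as \<psi> m \<le> 0"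
    using cm_cone_nonneg[OF cm_cone_foldr_nabla] by simp
qed

section \<open>Iterated unit differences\<close>

lemma completely_alternating_funpow_nabla:
  assumes "completely_alternating \<psi>"
  shows "(nabla a ^^ Suc N) \<psi> m \<le> 0"
proof -
  have "foldr nabla (replicate n a) \<psi> = (nabla a ^^ n) \<psi>" for n
    by (induction n) auto
  then show ?thesis
    using assms unfolding completely_alternating_def
    by (metis length_0_conv length_replicate nat.simps(3))
qed

lemma funpow_nabla_affine_combination:
  "(nabla a ^^ Suc N) (\<lambda>m. c - (p * f m + q * g m)) m
    = - (p * (nabla a ^^ Suc N) f m + q * (nabla a ^^ Suc N) g m)"
proof (induction N arbitrary: m)
  case 0
  then show ?case by (simp add: nabla_def algebra_simps)
next
  case (Suc N)
  have "(nabla a ^^ Suc N) (\<lambda>m. c - (p * f m + q * g m))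
      = (\<lambda>m. - (p * (nabla a ^^ Suc N) f m + q * (nabla a ^^ Suc N) g m))"
    using Suc by blast
  then show ?case
    unfolding funpow.simps(2)[of "Suc N"] o_apply by (simp only:) (simp add: nabla_def algebra_simps)
qed

text \<open>The Leibniz rule has only two terms here, since second differences of the linear factor
  vanish. Choosing c to cancel a denominator of f turns it into a recurrence in N.\<close>

lemma funpow_nabla_linear_mult:
  "(nabla 1 ^^ Suc N) (\<lambda>m. (real m + c) * f m) m
    = (real m + c + real (Suc N)) * (nabla 1 ^^ Suc N) f m - real (Suc N) * (nabla 1 ^^ N) f m"
proof (induction N arbitrary: m)
  case 0
  then show ?case by (simp add: nabla_def algebra_simps)
next
  case (Suc N)
  define F where "F = (nabla 1 ^^ N) f"
  have IH: "(nabla 1 ^^ Suc N) (\<lambda>m. (real m + c) * f m)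
      = (\<lambda>m. (real m + c + real (Suc N)) * nabla 1 F m - real (Suc N) * F m)"
    using Suc by (auto simp: F_def)
  have "(nabla 1 ^^ Suc (Suc N)) (\<lambda>m. (real m + c) * f m)
      = nabla 1 (\<lambda>m. (real m + c + real (Suc N)) * nabla 1 F m - real (Suc N) * F m)"
    using IH by simp
  moreover have "(nabla 1 ^^ Suc N) f = nabla 1 F" "(nabla 1 ^^ Suc (Suc N)) f = nabla 1 (nabla 1 F)"
    by (simp_all add: F_def)
  ultimately show ?case
    by (simp only:) (simp add: nabla_def algebra_simps)
qed

lemma funpow_nabla_const: "(nabla a ^^ Suc N) (\<lambda>m. c) = (\<lambda>m. 0)"
  by (induction N) (auto simp: nabla_def)

text \<open>The factor m+b cancels the denominator, and differences of the constant 1 vanish. The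
  recurrence has the solution N!/(b(b+1)...(b+N)).\<close>

lemma funpow_nabla_inv_Suc:
  assumes "b > 0"
  shows "(b + real (Suc N)) * (nabla 1 ^^ Suc N) (\<lambda>m. 1 / (real m + b)) 0
    = real (Suc N) * (nabla 1 ^^ N) (\<lambda>m. 1 / (real m + b)) 0"
proof -
  have "(\<lambda>m. (real m + b) * (1 / (real m + b))) = (\<lambda>m. 1)"
    using assms by (auto simp: fun_eq_iff add_nonneg_eq_0_iff)
  then show ?thesis
    using funpow_nabla_linear_mult[of N b "\<lambda>m. 1 / (real m + b)" 0]
    by (simp only: funpow_nabla_const) simp
qed

lemma funpow_nabla_inv_pos:
  assumes "b > 0"
  shows "(nabla 1 ^^ N) (\<lambda>m. 1 / (real m + b)) 0 > 0"
proof (induction N)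
  case 0
  then show ?case using assms by simp
next
  case (Suc N)
  have "(b + real (Suc N)) * (nabla 1 ^^ Suc N) (\<lambda>m. 1 / (real m + b)) 0 > 0"
    unfolding funpow_nabla_inv_Suc[OF assms] using Suc by simp
  then show ?case
    using assms by (simp add: zero_less_mult_iff del: funpow.simps)
qed

text \<open>
  The quotient $\rho_N$ of the two differences satisfies
  $(b_1 + N)\rho_N = (b_2 + N)\rho_{N-1} + 1$, so it grows at least like
  $\sum_k 1/(b_1 + k)$.
\<close>

lemma funpow_nabla_inv_mult_ge:
  assumes "0 < b1" and "b1 \<le> b2"
  shows "(nabla 1 ^^ N) (\<lambda>m. 1 / ((real m + b1) * (real m + b2))) 0
    \<ge> (ln (b1 + real N + 1) - ln (b1 + 1)) * (nabla 1 ^^ N) (\<lambda>m. 1 / (real m + b2)) 0"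
proof (induction N)
  case 0
  then show ?case using assms by simp
next
  case (Suc N)
  define G where "G n = (nabla 1 ^^ n) (\<lambda>m. 1 / (real m + b2)) 0" for n
  define W where "W n = (nabla 1 ^^ n) (\<lambda>m. 1 / ((real m + b1) * (real m + b2))) 0" for n
  \<comment> \<open>A logarithmic stand-in for the harmonic-type sum, normalised so that
    \<open>L 0 = 0\<close> and the base case only needs positivity.\<close>
  define L where "L n = ln (b1 + real n + 1) - ln (b1 + 1)" for n
  have "(\<lambda>m. (real m + b1) * (1 / ((real m + b1) * (real m + b2)))) = (\<lambda>m. 1 / (real m + b2))"
    using assms by (auto simp: fun_eq_iff add_nonneg_eq_0_iff)
  then have W: "(b1 + real (Suc N)) * W (Suc N) = G (Suc N) + real (Suc N) * W N"
    using funpow_nabla_linear_mult[of N b1 "\<lambda>m. 1 / ((real m + b1) * (real m + b2))" 0]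
    by (simp add: G_def W_def)
  have G: "(b2 + real (Suc N)) * G (Suc N) = real (Suc N) * G N"
    using funpow_nabla_inv_Suc[of b2 N] assms by (simp add: G_def)
  have Gpos: "G (Suc N) > 0"
    unfolding G_def using assms by (intro funpow_nabla_inv_pos) auto
  have "L N \<ge> 0" using assms by (simp add: L_def)
  \<comment> \<open>This is ln(x+1) - ln x <= 1/x at x = b1 + N + 1.\<close>
  have "L (Suc N) - L N \<le> 1 / (b1 + real (Suc N))"
    using ln_diff_le[of "b1 + real (Suc N) + 1" "b1 + real (Suc N)"] assms
    by (simp add: L_def algebra_simps)
  then have "(b1 + real (Suc N)) * (L (Suc N) - L N) \<le> 1"
    using assms by (simp add: field_simps)
  then have "(b1 + real (Suc N)) * L (Suc N) \<le> 1 + (b1 + real (Suc N)) * L N"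
    by (simp add: algebra_simps)
  \<comment> \<open>The order of b1 and b2 enters here: raising b1 to b2 matches the recurrence of
    \<open>G\<close>.\<close>
  also have "\<dots> \<le> 1 + (b2 + real (Suc N)) * L N"
    using \<open>L N \<ge> 0\<close> assms by (intro add_left_mono mult_right_mono) auto
  finally have "(b1 + real (Suc N)) * L (Suc N) * G (Suc N)
      \<le> (1 + (b2 + real (Suc N)) * L N) * G (Suc N)"
    using Gpos by (intro mult_right_mono) auto
  also have "\<dots> = G (Suc N) + L N * ((b2 + real (Suc N)) * G (Suc N))"
    by (simp add: algebra_simps)
  also have "\<dots> = G (Suc N) + real (Suc N) * (L N * G N)"
    unfolding G by simp
  also have "\<dots> \<le> G (Suc N) + real (Suc N) * W N"
    using Suc by (intro add_left_mono mult_left_mono) (auto simp: L_def G_def W_def)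
  also have "\<dots> = (b1 + real (Suc N)) * W (Suc N)"
    using W by simp
  finally have "(b1 + real (Suc N)) * (L (Suc N) * G (Suc N)) \<le> (b1 + real (Suc N)) * W (Suc N)"
    by (simp add: mult.assoc)
  then have "L (Suc N) * G (Suc N) \<le> W (Suc N)"
    using assms by (subst (asm) mult_le_cancel_left_pos) auto
  then show ?case
    by (simp only: L_def G_def W_def)
qed

section \<open>Characterisation for rational sequences\<close>

text \<open>The second basis function is the product, not 1/(n+b1): this covers b1 = b2 and makes
  the criterion a separate sign condition on each coefficient.\<close>

lemma completely_alternating_rational_iff:
  assumes "0 < b1" and "b1 \<le> b2"
  shows "completely_alternating
      (\<lambda>n. c - (P * (1 / (real n + b2)) + Q * (1 / ((real n + b1) * (real n + b2)))))
    \<longleftrightarrow> P \<ge> 0 \<and> Q \<ge> 0" (is "completely_alternating ?\<psi> \<longleftrightarrow> _")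
proof
  assume ca: "completely_alternating ?\<psi>"
  define h where "h n = P * (1 / (real n + b2)) + Q * (1 / ((real n + b1) * (real n + b2)))" for n
  have "P \<ge> 0"
  proof -
    \<comment> \<open>A nonincreasing sequence with limit 0 is nonnegative; multiplying
      \<open>h m\<close> by m+b2 and letting m grow then isolates P.\<close>
    have dec: "h (m + a) \<le> h m" for m a
    proof -
      have "nabla a ?\<psi> m \<le> 0"
        using completely_alternating_funpow_nabla[OF ca, where a = a and N = 0 and m = m] by simp
      then show ?thesis
        unfolding nabla_def h_def by linarith
    qed
    have lim: "(\<lambda>a. h (m + a)) \<longlonglongrightarrow> 0" for m
      unfolding h_def by real_asymp
    have h: "h m \<ge> 0" for m
      by (rule LIMSEQ_le_const2[OF lim]) (use dec in blast)
    have "P + Q / (real m + b1) \<ge> 0" for m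
    proof -
      have "0 \<le> (real m + b2) * h m"
        using h[of m] assms by simp
      also have "\<dots> = P + Q / (real m + b1)"
      proof -
        have "x * (P * (1 / x) + Q * (1 / (y * x))) = P + Q / y" if "x \<noteq> 0" "y \<noteq> 0" for x y
          using that by (simp add: field_simps)
        then show ?thesis
          unfolding h_def using assms by (smt (verit) of_nat_0_le_iff)
      qed
      finally show ?thesis .
    qed
    moreover have "(\<lambda>m. P + Q / (real m + b1)) \<longlonglongrightarrow> P"
      by real_asymp
    ultimately show ?thesis
      by (intro LIMSEQ_le_const) auto
  qed
  moreover have "Q \<ge> 0"
  proof (rule ccontr)
    assume "\<not> Q \<ge> 0"
    then have Q: "Q < 0" by simp
    define L where "L n = ln (b1 + real n + 1) - ln (b1 + 1)" for n
    \<comment> \<open>Since Q < 0, the lower bound on \<open>W\<close> bounds Q*W from above;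
      dividing by \<open>G > 0\<close> leaves an expression that tends to minus infinity with
      \<open>L\<close>.\<close>
    have bound: "0 \<le> P + Q * L (Suc N)" for N
    proof -
      define G where "G = (nabla 1 ^^ Suc N) (\<lambda>m. 1 / (real m + b2)) 0"
      define W where "W = (nabla 1 ^^ Suc N) (\<lambda>m. 1 / ((real m + b1) * (real m + b2))) 0"
      have "G > 0"
        unfolding G_def using assms by (intro funpow_nabla_inv_pos) auto
      have "W \<ge> L (Suc N) * G"
        unfolding W_def G_def L_def by (rule funpow_nabla_inv_mult_ge[OF assms])
      have "0 \<le> P * G + Q * W"
        using completely_alternating_funpow_nabla[OF ca, where a = 1 and N = N and m = 0]
        unfolding funpow_nabla_affine_combination G_def W_def by linarith
      also have "\<dots> \<le> P * G + Q * (L (Suc N) * G)"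
        using \<open>W \<ge> L (Suc N) * G\<close> Q by (intro add_left_mono mult_left_mono_neg) auto
      also have "\<dots> = (P + Q * L (Suc N)) * G"
        by (simp add: algebra_simps)
      finally show ?thesis
        using \<open>G > 0\<close> by (simp add: zero_le_mult_iff)
    qed
    have "filterlim (\<lambda>N. L (Suc N)) at_top sequentially"
      unfolding L_def by real_asymp
    then obtain N where "L (Suc N) > P / (- Q)"
      by (metis (mono_tags, lifting) eventually_sequentially filterlim_at_top_dense le_refl)
    then have "P + Q * L (Suc N) < 0"
      using Q by (simp add: field_simps)
    then show False using bound[of N] by simp
  qed
  ultimately show "P \<ge> 0 \<and> Q \<ge> 0" ..
next
  assume PQ: "P \<ge> 0 \<and> Q \<ge> 0"
  let ?h = "\<lambda>n. P * (1 / (real n + b2)) + Q * (1 / (real n + b1) * (1 / (real n + b2)))"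
  have "cm_cone ?h"
    using PQ assms by (intro cm_cone.add cm_cone.mult cm_cone.const cm_cone.inv) auto
  then show "completely_alternating ?\<psi>"
    by (rule completely_alternating_affine_minus_cm_cone[where c = c and d = 0]) auto
qed

section \<open>The three rational functions\<close>

lemma mult_diff_nonpos_iff:
  fixes a1 a2 b :: real
  assumes "a1 \<le> a2"
  shows "(a1 - b) * (a2 - b) \<le> 0 \<longleftrightarrow> a1 \<le> b \<and> b \<le> a2"
  using assms by (auto simp: mult_le_0_iff)

theorem theorem3p1:
  fixes a1 a2 b1 b2 :: real
  assumes "a1 \<le> a2" and "0 < b1" and "b1 \<le> b2"
  shows "(completely_alternating (\<lambda>n. (real n + a1) / (real n + b1)) \<longleftrightarrow> a1 \<le> b1)
    \<and> (completely_alternating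
          (\<lambda>n. ((real n + a1) * (real n + a2)) / ((real n + b1) * (real n + b2)))
        \<longleftrightarrow> a1 \<le> b1 \<and> b1 \<le> a2 \<and> a1 + a2 \<le> b1 + b2)
    \<and> (completely_alternating (\<lambda>n. ((real n + a1) * (real n + a2)) / (real n + b1))
        \<longleftrightarrow> a1 \<le> b1 \<and> b1 \<le> a2)"
proof (intro conjI)
  have nz: "real n + b1 \<noteq> 0" "real n + b2 \<noteq> 0" for n
    using assms by linarith+
  \<comment> \<open>The value of (x+a1)(x+a2) at x = -b1; its sign decides whether b1 lies between
    a1 and a2.\<close>
  define D where "D = (a1 - b1) * (a2 - b1)"
  have D: "D \<le> 0 \<longleftrightarrow> a1 \<le> b1 \<and> b1 \<le> a2"
    unfolding D_def using assms(1) by (rule mult_diff_nonpos_iff)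

  \<comment> \<open>The criterion is applied with both denominators equal to n+b1 and Q = 0.\<close>
  have "(\<lambda>n. (real n + a1) / (real n + b1))
      = (\<lambda>n. 1 - ((b1 - a1) * (1 / (real n + b1)) + 0 * (1 / ((real n + b1) * (real n + b1)))))"
    using nz by (auto simp: fun_eq_iff field_simps)
  then show "completely_alternating (\<lambda>n. (real n + a1) / (real n + b1)) \<longleftrightarrow> a1 \<le> b1"
    using completely_alternating_rational_iff[of b1 b1 1 "b1 - a1" 0] assms by simp

  \<comment> \<open>Newton-type expansion of the numerator in 1, x+b1, (x+b1)(x+b2); evaluating at x
    = -b1 gives Q = -D.\<close>
  have "((real n + a1) * (real n + a2)) / ((real n + b1) * (real n + b2))
      = 1 - ((b1 + b2 - a1 - a2) * (1 / (real n + b2))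
          + (- D) * (1 / ((real n + b1) * (real n + b2))))" for n
    using nz[of n] by (simp add: D_def divide_simps) (simp add: algebra_simps)
  then show "completely_alternating
          (\<lambda>n. ((real n + a1) * (real n + a2)) / ((real n + b1) * (real n + b2)))
        \<longleftrightarrow> a1 \<le> b1 \<and> b1 \<le> a2 \<and> a1 + a2 \<le> b1 + b2"
    using completely_alternating_rational_iff[of b1 b2 1 "b1 + b2 - a1 - a2" "- D"] assms D
    by auto

  let ?\<psi> = "\<lambda>n. ((real n + a1) * (real n + a2)) / (real n + b1)"
  \<comment> \<open>Polynomial division by n+b1, with remainder D.\<close>
  have \<psi>: "?\<psi> n = (a1 + a2 - b1) + 1 * real n - (- D) * (1 / (real n + b1))" for n
    using nz[of n] by (simp add: D_def divide_simps) (simp add: algebra_simps)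
  show "completely_alternating ?\<psi> \<longleftrightarrow> a1 \<le> b1 \<and> b1 \<le> a2"
  proof
    assume "completely_alternating ?\<psi>"
    \<comment> \<open>\<open>N = 1\<close> means two differences, just enough to remove the affine
      part; what remains is D times the positive second difference of 1/(n+b1) at 0.\<close>
    from completely_alternating_funpow_nabla[OF this, where a = 1 and N = 1 and m = 0]
    have "?\<psi> 0 - 2 * ?\<psi> 1 + ?\<psi> 2 \<le> 0"
      by (simp add: nabla_def eval_nat_numeral)
    then have "D * (1 / b1 - 2 / (1 + b1) + 1 / (2 + b1)) \<le> 0"
      unfolding \<psi> by (simp add: algebra_simps)
    moreover have "1 / b1 - 2 / (1 + b1) + 1 / (2 + b1) = 2 / (b1 * (1 + b1) * (2 + b1))"
      using assms by (simp add: divide_simps) (simp add: algebra_simps)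
    moreover have "2 / (b1 * (1 + b1) * (2 + b1)) > 0"
      using assms by simp
    ultimately have "D \<le> 0"
      by (metis mult_le_0_iff not_less)
    then show "a1 \<le> b1 \<and> b1 \<le> a2" using D by simp
  next
    assume "a1 \<le> b1 \<and> b1 \<le> a2"
    then have "cm_cone (\<lambda>n. (- D) * (1 / (real n + b1)))"
      using assms D by (intro cm_cone.mult cm_cone.const cm_cone.inv) auto
    then show "completely_alternating ?\<psi>"
      by (rule completely_alternating_affine_minus_cm_cone[OF _ zero_le_one \<psi>])
  qed
qed

end
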